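(* Let $k \ge 3$ be an integer and let $p_{2k}(x,y) = x^k y^k$. Then $$L_{\mathbb{Q}(\zeta_{k+1})}(p_{2k}) = k+1, \qquad L_{\mathbb{Q}(\zeta_k)}(p_{2k}) = k+2, \qquad L_{\mathbb{R}}(p_{2k}) = 2k > k+2.$$
   Context: $\zeta_m$ denotes a primitive $m$-th root of unity in $\mathbb{C}$ (e.g. $\zeta_m = e^{2\pi i/m}$). For a binary form (homogeneous polynomial) $f(x,y)$ of degree $d$ with coefficients in a field $K \subseteq \mathbb{C}$, the $K$-rank (or $K$-length) $L_K(f)$ is the smallest integer $r$ for which there is a representation $$f(x,y) = \sum_{j=1}^r \lambda_j(\alpha_j x + \beta_j y)^d$$ with $\lambda_j, \alpha_j, \beta_j \in K$ for all $j$. *)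

theory Defs
  imports
    "HOL-Algebra.Algebraic_Closure_Type"
    "HOL-Algebra.Generated_Fields"
    "HOL-Library.Extended_Nat"
    Complex_Main
begin

(* Bivariate polynomials over the complex numbers are elements of C[x][y]: the inner
   polynomial indeterminate is x, the outer one is y. *)

definition var_x :: "complex poly poly" where
  "var_x = [:[:0, 1:]:]"

definition var_y :: "complex poly poly" where
  "var_y = [:0, 1:]"

definition const2 :: "complex \<Rightarrow> complex poly poly" where
  "const2 c = [:[:c:]:]"

definition has_power_sum_rep :: "complex set \<Rightarrow> nat \<Rightarrow> complex poly poly \<Rightarrow> nat \<Rightarrow> bool" where
  "has_power_sum_rep K d f r \<longleftrightarrow>
     (\<exists>lam \<alpha> \<beta> :: nat \<Rightarrow> complex.
        (\<forall>j\<in>{1..r}. lam j \<in> K \<and> \<alpha> j \<in> K \<and> \<beta> j \<in> K) \<and>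
        f = (\<Sum>j=1..r. const2 (lam j) * (const2 (\<alpha> j) * var_x + const2 (\<beta> j) * var_y) ^ d))"

(* The K-length of a binary form f of degree d. As an infimum in the extended naturals it is
   infinite if f has no representation at all, and otherwise it is the least number of
   summands. The degree is a separate argument because the zero form has every degree. *)
definition form_length :: "complex set \<Rightarrow> nat \<Rightarrow> complex poly poly \<Rightarrow> enat" where
  "form_length K d f = (INF r\<in>{r. has_power_sum_rep K d f r}. enat r)"

(* Q(z): a subfield of the complex numbers always contains the rationals, so this is the
   subfield generated by z alone. *)
definition rat_adjoin :: "complex \<Rightarrow> complex set" where
  "rat_adjoin z = generate_field (ring_of_type_algebra :: complex ring) {z}"

definition primitive_root_of_unity :: "nat \<Rightarrow> complex \<Rightarrow> bool" where
  "primitive_root_of_unity m z \<longleftrightarrow>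
     0 < m \<and> z ^ m = 1 \<and> (\<forall>j. 0 < j \<and> j < m \<longrightarrow> z ^ j \<noteq> 1)"

end

(* Dehomogenise: the linear forms of a representation of x^k y^k give finitely many nodes s in K
   and weights whose i-th moments vanish except for i = k. Testing the moments on multiples of the
   node polynomial h = prod (X - s) kills coefficients of h (this is apolarity). Fewer than k + 1
   forms would kill the leading coefficient. With exactly k + 1 forms, h = X^(k+1) + c, so K contains
   all (k+1)-th roots of unity; this is impossible for K = Q(zeta_k), because a prime p dividing
   k + 1 does not ramify there. Over the reals, fewer than 2k forms would make two adjacent
   coefficients of h vanish below the leading one, which Rolle's theorem forbids for a polynomial
   with simple real roots. The representations are discrete Fourier sums over the roots of unity,
   and over the reals a quadrature rule on symmetric nodes. *)

theory Submission
  imports Defs "HOL-Number_Theory.Residues"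
begin

section \<open>Primes in the order generated by a root of unity\<close>

text \<open>The ring Z[w]. As an inductive closure it allows the Frobenius congruence to be proved
  by rule induction.\<close>

inductive_set int_adjoin :: "complex \<Rightarrow> complex set" for w where
  of_int: "of_int n \<in> int_adjoin w"
| generator: "w \<in> int_adjoin w"
| add: "x \<in> int_adjoin w \<Longrightarrow> y \<in> int_adjoin w \<Longrightarrow> x + y \<in> int_adjoin w"
| mult: "x \<in> int_adjoin w \<Longrightarrow> y \<in> int_adjoin w \<Longrightarrow> x * y \<in> int_adjoin w"

lemma int_adjoin_0: "0 \<in> int_adjoin w"
  using int_adjoin.of_int[of 0 w] by simp

lemma int_adjoin_1: "1 \<in> int_adjoin w"
  using int_adjoin.of_int[of 1 w] by simp

lemma int_adjoin_of_nat: "of_nat n \<in> int_adjoin w"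
  using int_adjoin.of_int[of "int n" w] by simp

lemma int_adjoin_uminus: "x \<in> int_adjoin w \<Longrightarrow> - x \<in> int_adjoin w"
  using int_adjoin.mult[OF int_adjoin.of_int[of "-1"]] by fastforce

lemma int_adjoin_power: "x \<in> int_adjoin w \<Longrightarrow> x ^ n \<in> int_adjoin w"
  by (induction n) (auto intro: int_adjoin_1 int_adjoin.mult)

text \<open>Membership in the ideal p Z[w]. A congruence modulo p is expressed as this property of a
  difference.\<close>

definition int_adjoin_multiple :: "complex \<Rightarrow> nat \<Rightarrow> complex \<Rightarrow> bool" where
  "int_adjoin_multiple w p x \<longleftrightarrow> (\<exists>u\<in>int_adjoin w. x = of_nat p * u)"

lemma int_adjoin_multipleI: "u \<in> int_adjoin w \<Longrightarrow> int_adjoin_multiple w p (of_nat p * u)"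
  unfolding int_adjoin_multiple_def by blast

lemma int_adjoin_multiple_0: "int_adjoin_multiple w p 0"
  using int_adjoin_multipleI[OF int_adjoin_0] by simp

lemma int_adjoin_multiple_add:
  "int_adjoin_multiple w p x \<Longrightarrow> int_adjoin_multiple w p y \<Longrightarrow> int_adjoin_multiple w p (x + y)"
  unfolding int_adjoin_multiple_def by (metis distrib_left int_adjoin.add)

lemma int_adjoin_multiple_mult:
  "int_adjoin_multiple w p x \<Longrightarrow> y \<in> int_adjoin w \<Longrightarrow> int_adjoin_multiple w p (y * x)"
  unfolding int_adjoin_multiple_def by (metis int_adjoin.mult mult.left_commute)

lemma int_adjoin_multiple_uminus:
  "int_adjoin_multiple w p x \<Longrightarrow> int_adjoin_multiple w p (- x)"
  using int_adjoin_multiple_mult[OF _ int_adjoin_uminus[OF int_adjoin_1]] by force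

lemma int_adjoin_multiple_diff:
  "int_adjoin_multiple w p x \<Longrightarrow> int_adjoin_multiple w p y \<Longrightarrow> int_adjoin_multiple w p (x - y)"
  using int_adjoin_multiple_add[OF _ int_adjoin_multiple_uminus] by force

lemma int_adjoin_multiple_sum:
  "(\<And>i. i \<in> A \<Longrightarrow> int_adjoin_multiple w p (f i)) \<Longrightarrow> int_adjoin_multiple w p (sum f A)"
  by (induction A rule: infinite_finite_induct)
    (auto intro: int_adjoin_multiple_0 int_adjoin_multiple_add)

section \<open>Frobenius modulo p\<close>

lemma prime_dvd_choose_prime_power:
  fixes p :: nat
  assumes "prime p" "0 < i" "i < p ^ f"
  shows "p dvd (p ^ f choose i)"
proof (rule ccontr)
  assume "\<not> p dvd (p ^ f choose i)"
  then have "coprime (p ^ f) (p ^ f choose i)"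
    using assms(1) by (simp add: prime_imp_coprime)
  \<comment> \<open>Absorption identity: coprimality would push all of \<open>p ^ f\<close> into
    \<open>i\<close>, although \<open>0 < i < p ^ f\<close>.\<close>
  moreover have "i * (p ^ f choose i) = p ^ f * (p ^ f - 1 choose (i - 1))"
    using times_binomial_minus1_eq[OF assms(2)] by simp
  then have "p ^ f dvd i * (p ^ f choose i)" by simp
  ultimately have "p ^ f dvd i"
    by (simp add: coprime_dvd_mult_left_iff)
  then show False using assms by (simp add: nat_dvd_not_less)
qed

lemma int_adjoin_multiple_freshman:
  assumes "prime p" "x \<in> int_adjoin w" "y \<in> int_adjoin w"
  shows "int_adjoin_multiple w p ((x + y) ^ (p ^ f) - x ^ (p ^ f) - y ^ (p ^ f))"
proof -
  let ?q = "p ^ f"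
  let ?t = "\<lambda>i. of_nat (?q choose i) * x ^ i * y ^ (?q - i)"
  have q: "0 < ?q" using assms(1) prime_gt_0_nat by simp
  have split: "{..?q} = insert 0 (insert ?q {1..<?q})" using q by auto
  have "(x + y) ^ ?q = sum ?t {..?q}" by (rule binomial_ring)
  also have "\<dots> = y ^ ?q + x ^ ?q + sum ?t {1..<?q}"
    using q by (subst split) (simp add: add.assoc)
  finally have "(x + y) ^ ?q - x ^ ?q - y ^ ?q = sum ?t {1..<?q}" by simp
  moreover have "int_adjoin_multiple w p (?t i)" if i: "i \<in> {1..<?q}" for i
  proof -
    obtain c where c: "(?q choose i) = p * c"
      using prime_dvd_choose_prime_power[OF assms(1), of i f] i by (fastforce elim: dvdE)
    have "?t i = of_nat p * (of_nat c * x ^ i * y ^ (?q - i))"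
      unfolding c by simp
    then show ?thesis
      by (simp only:) (intro int_adjoin_multipleI int_adjoin.mult int_adjoin_of_nat
          int_adjoin_power assms)
  qed
  ultimately show ?thesis by (simp only: int_adjoin_multiple_sum)
qed

text \<open>The elements fixed modulo p by the \<open>p ^ f\<close>-power map are closed under sums
  (the mixed binomial terms vanish modulo p) and products; they contain the integers by iterated
  Fermat and w by assumption.\<close>

lemma int_adjoin_frobenius:
  assumes "prime p" "w ^ (p ^ f) = w" "v \<in> int_adjoin w"
  shows "int_adjoin_multiple w p (v ^ (p ^ f) - v)"
  using assms(3)
proof induction
  case (of_int n)
  have "[n ^ (p ^ f) = n] (mod int p)"
  proof (induction f)
    case (Suc f)
    have *: "[a ^ p = a] (mod int p)" for a :: int
    proof -
      define b where "b = nat (a mod int p)"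
      have ab: "[int b = a] (mod int p)"
        using prime_gt_0_nat[OF assms(1)] by (simp add: b_def)
      have "[b ^ p = b] (mod p)"
      proof (cases "p dvd b")
        case True
        moreover from this have "p dvd b ^ p"
          using prime_gt_0_nat[OF assms(1)] by (simp add: dvd_trans[OF _ dvd_power])
        ultimately show ?thesis by (simp add: cong_def mod_0_imp_dvd dvd_imp_mod_0)
      next
        case False
        have "[b * b ^ (p - 1) = b * 1] (mod p)"
          by (rule cong_scalar_left[OF fermat_theorem[OF assms(1) False]])
        then show ?thesis using prime_gt_0_nat[OF assms(1)]
          by (simp add: power_eq_if)
      qed
      then have "[int b ^ p = int b] (mod int p)" 
        by (simp add: cong_int_iff[symmetric])
      then show ?thesis using ab cong_pow[OF ab, of p] cong_trans cong_sym by blast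
    qed
    have "n ^ p ^ Suc f = (n ^ (p ^ f)) ^ p"
      by (simp only: power_Suc power_mult[symmetric] mult.commute[of p])
    then show ?case using *[of "n ^ (p ^ f)"] Suc.IH cong_trans by simp
  qed simp
  then obtain c where "n ^ (p ^ f) - n = int p * c"
    by (auto simp: cong_iff_dvd_diff)
  then have "of_int n ^ (p ^ f) - of_int n = of_nat p * (of_int c :: complex)"
    by (metis of_int_diff of_int_mult of_int_of_nat_eq of_int_power)
  then show ?case by (simp add: int_adjoin_multipleI int_adjoin.of_int)
next
  case generator
  then show ?case by (simp add: assms(2) int_adjoin_multiple_0)
next
  case (add x y)
  have "(x + y) ^ (p ^ f) - (x + y) = ((x + y) ^ (p ^ f) - x ^ (p ^ f) - y ^ (p ^ f))
      + ((x ^ (p ^ f) - x) + (y ^ (p ^ f) - y))" by simp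
  then show ?case
    by (simp only:) (intro int_adjoin_multiple_add int_adjoin_multiple_freshman assms add)
next
  case (mult x y)
  have "(x * y) ^ (p ^ f) - x * y = y ^ (p ^ f) * (x ^ (p ^ f) - x) + x * (y ^ (p ^ f) - y)"
    by (simp add: power_mult_distrib algebra_simps)
  then show ?case
    by (simp only:) (intro int_adjoin_multiple_add int_adjoin_multiple_mult int_adjoin_power mult)
qed

text \<open>Modulo p the power map is the identity, so it kills only zero. This later removes a
  factor p from a denominator.\<close>

lemma int_adjoin_reduced:
  assumes "prime p" "w ^ (p ^ f) = w" "v \<in> int_adjoin w" "int_adjoin_multiple w p (v ^ (p ^ f))"
  shows "int_adjoin_multiple w p v"
  using int_adjoin_multiple_diff[OF assms(4) int_adjoin_frobenius[OF assms(1-3)]] by simp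

text \<open>Nakayama's lemma for a finitely generated group of complex numbers, localised at p:
  the multipliers \<open>N i\<close> prime to p play the role of units, and the generators are
  eliminated one at a time.\<close>

lemma p_divisible_lattice_trivial:
  fixes g :: "nat \<Rightarrow> complex" and p :: int
  assumes "prime p"
    and "\<forall>i<n. \<not> p dvd N i \<and> of_int (N i) * g i = of_int p * (\<Sum>j<n. of_int (c i j) * g j)"
  shows "\<forall>i<n. g i = 0"
  using assms(2)
proof (induction n arbitrary: N c)
  case (Suc n)
  \<comment> \<open>The diagonal term of the last relation is moved to its left side.
    \<open>D\<close> stays prime to p, so it acts as a unit and the last generator can be eliminated
    from the other relations.\<close>
  define D where "D = N n - p * c n n"
  have D: "\<not> p dvd D" using Suc.prems by (auto simp: D_def dvd_diff_left_iff)
  have last: "of_int D * g n = of_int p * (\<Sum>j<n. of_int (c n j) * g j)"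
  proof -
    have "of_int (N n) * g n = of_int p * (\<Sum>j<Suc n. of_int (c n j) * g j)"
      using Suc.prems by blast
    then show ?thesis by (simp add: D_def algebra_simps)
  qed
  have "of_int (D * N i) * g i
      = of_int p * (\<Sum>j<n. of_int (D * c i j + p * c i n * c n j) * g j)" if "i < n" for i
  proof -
    have "of_int (N i) * g i = of_int p * (\<Sum>j<Suc n. of_int (c i j) * g j)"
      using Suc.prems that less_SucI by blast
    then have "of_int (D * N i) * g i
        = of_int D * (of_int p * (\<Sum>j<n. of_int (c i j) * g j)) + of_int p * of_int (c i n) * (of_int D * g n)"
      by (simp add: algebra_simps)
    also have "\<dots> = of_int p * (of_int D * (\<Sum>j<n. of_int (c i j) * g j)
        + of_int p * of_int (c i n) * (\<Sum>j<n. of_int (c n j) * g j))"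
      unfolding last by (simp add: algebra_simps)
    also have "\<dots> = of_int p * (\<Sum>j<n. of_int (D * c i j + p * c i n * c n j) * g j)"
      by (simp add: sum_distrib_left sum.distrib algebra_simps)
    finally show ?thesis .
  qed
  moreover have "\<not> p dvd D * N i" if "i < n" for i
    using D Suc.prems that prime_dvd_multD[OF assms(1)] less_SucI by blast
  ultimately have IH: "\<forall>i<n. g i = 0"
    using Suc.IH[of "\<lambda>i. D * N i" "\<lambda>i j. D * c i j + p * c i n * c n j"] by blast
  then have "of_int D * g n = 0" using last by simp
  moreover have "D \<noteq> 0" using D by auto
  ultimately show ?case using IH by (simp add: less_Suc_eq)
qed simp

text \<open>Exponents may be reduced modulo k, so finitely many powers of w generate Z[w] as a
  group. The Nakayama argument needs this finiteness; the coefficients need not be unique.\<close>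

lemma int_adjoin_span:
  assumes "0 < k" "w ^ k = 1" "v \<in> int_adjoin w"
  shows "\<exists>c. v = (\<Sum>j<k. of_int (c j) * w ^ j)"
proof -
  let ?S = "{v. \<exists>c. v = (\<Sum>j<k. of_int (c j) * w ^ j)}"
  have add: "x + y \<in> ?S" if xy: "x \<in> ?S" "y \<in> ?S" for x y
  proof -
    from xy obtain c d where "x = (\<Sum>j<k. of_int (c j) * w ^ j)" "y = (\<Sum>j<k. of_int (d j) * w ^ j)"
      by blast
    then have "x + y = (\<Sum>j<k. of_int (c j + d j) * w ^ j)"
      by (simp add: sum.distrib algebra_simps)
    then show ?thesis by (blast intro: exI[of _ "\<lambda>j. c j + d j"])
  qed
  have scal: "of_int n * x \<in> ?S" if x: "x \<in> ?S" for n x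
  proof -
    from x obtain c where "x = (\<Sum>j<k. of_int (c j) * w ^ j)" by blast
    then have "of_int n * x = (\<Sum>j<k. of_int (n * c j) * w ^ j)"
      by (simp add: sum_distrib_left algebra_simps)
    then show ?thesis by (blast intro: exI[of _ "\<lambda>j. n * c j"])
  qed
  have zero: "0 \<in> ?S" by (auto intro: exI[of _ "\<lambda>_. 0"])
  have sum: "sum f A \<in> ?S" if "\<And>i. i \<in> A \<Longrightarrow> f i \<in> ?S" for f :: "nat \<Rightarrow> complex" and A
    using that
  proof (induction A rule: infinite_finite_induct)
    case (insert i A)
    then have "f i + sum f A \<in> ?S" by (intro add) blast+
    then show ?case using insert(1,2) by simp
  qed (use zero in auto)
  have pw: "w ^ i \<in> ?S" for i
  proof -
    have "w ^ i = w ^ (k * (i div k) + i mod k)" by simp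
    also have "\<dots> = w ^ (i mod k)" by (simp only: power_add power_mult assms(2)) simp
    also have "\<dots> = (\<Sum>j<k. if j = i mod k then w ^ j else 0)"
      using assms(1) by (subst sum.delta) auto
    also have "\<dots> = (\<Sum>j<k. of_int (if j = i mod k then 1 else 0) * w ^ j)"
      by (rule sum.cong) auto
    finally show ?thesis by (blast intro: exI[of _ "\<lambda>j. if j = i mod k then 1 else 0"])
  qed
  from assms(3) have "v \<in> ?S"
  proof induction
    case (of_int n)
    show ?case using scal[OF pw[of 0], of n] by simp
  next
    case generator
    show ?case using pw[of 1] by simp
  next
    case (add x y)
    then show ?case by (intro \<open>\<And>x y. x \<in> ?S \<Longrightarrow> y \<in> ?S \<Longrightarrow> x + y \<in> ?S\<close>)
  next
    case (mult x y)
    from mult.IH obtain c where x: "x = (\<Sum>j<k. of_int (c j) * w ^ j)" by blast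
    from mult.IH obtain d where y: "y = (\<Sum>j<k. of_int (d j) * w ^ j)" by blast
    have "x * y = (\<Sum>i<k. \<Sum>j<k. of_int (c i * d j) * w ^ (i + j))"
      unfolding x y sum_product by (simp add: power_add algebra_simps)
    also have "\<dots> \<in> ?S" by (intro sum scal pw)
    finally show ?case .
  qed
  then show ?thesis by blast
qed

text \<open>If \<open>N = p * u\<close> with N prime to p, multiplying this equation by each
  generator \<open>w ^ i\<close> gives a system to which the Nakayama lemma applies; then even
  \<open>w ^ 0 = 1\<close> would vanish.\<close>

lemma int_adjoin_multiple_of_int_dvd:
  assumes "0 < k" "w ^ k = 1" "prime p" "int_adjoin_multiple w p (of_int N)"
  shows "int p dvd N"
proof (rule ccontr)
  assume N: "\<not> int p dvd N"
  obtain u where u: "u \<in> int_adjoin w" "of_int N = of_nat p * u"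
    using assms(4) unfolding int_adjoin_multiple_def by blast
  have "\<forall>i. \<exists>c. u * w ^ i = (\<Sum>j<k. of_int (c j) * w ^ j)"
    using int_adjoin_span[OF assms(1,2)] u(1)
    by (blast intro: int_adjoin.mult int_adjoin_power int_adjoin.generator)
  then obtain c where c: "\<And>i. u * w ^ i = (\<Sum>j<k. of_int (c i j) * w ^ j)" by metis
  have "\<forall>i<k. \<not> int p dvd N \<and>
      of_int N * w ^ i = of_int (int p) * (\<Sum>j<k. of_int (c i j) * w ^ j)"
  proof (intro allI impI conjI)
    fix i
    show "of_int N * w ^ i = of_int (int p) * (\<Sum>j<k. of_int (c i j) * w ^ j)"
      unfolding c[symmetric] u(2) by simp
  qed (rule N)
  then have "\<forall>i<k. w ^ i = 0"
    using p_divisible_lattice_trivial[of "int p" k "\<lambda>_. N" "\<lambda>i. w ^ i" c]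
      prime_nat_int_transfer[of p] assms(3) by blast
  then show False using assms(1) by force
qed

section \<open>Cyclotomic fields\<close>

abbreviation complex_ring :: "complex ring" where
  "complex_ring \<equiv> ring_of_type_algebra"

lemma complex_ring_simps:
  "carrier complex_ring = UNIV" "x \<otimes>\<^bsub>complex_ring\<^esub> y = x * y" "\<one>\<^bsub>complex_ring\<^esub> = 1"
  "x \<oplus>\<^bsub>complex_ring\<^esub> y = x + y" "\<zero>\<^bsub>complex_ring\<^esub> = 0"
  by (simp_all add: ring_of_type_algebra_def)

lemma complex_ring_uminus: "\<ominus>\<^bsub>complex_ring\<^esub> x = - x"
proof -
  interpret complex_ring: field complex_ring
    by (rule field_from_type_algebra)
  show ?thesis
    using complex_ring.minus_equality[of "- x" x] by (simp add: complex_ring_simps)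
qed

lemma complex_ring_inv:
  assumes "x \<noteq> 0"
  shows "inv\<^bsub>complex_ring\<^esub> x = inverse x"
proof -
  interpret complex_ring: field complex_ring
    by (rule field_from_type_algebra)
  show ?thesis
    using complex_ring.comm_inv_char[of x "inverse x"] assms by (simp add: complex_ring_simps)
qed

lemma complex_ring_pow: "x [^]\<^bsub>complex_ring\<^esub> (n::nat) = x ^ n"
  by (induction n) (simp_all add: nat_pow_def complex_ring_simps mult.commute)

lemma subfield_complex_ringI:
  assumes "1 \<in> K" "\<And>x y. x \<in> K \<Longrightarrow> y \<in> K \<Longrightarrow> x - y \<in> K"
    "\<And>x y. x \<in> K \<Longrightarrow> y \<in> K \<Longrightarrow> x * y \<in> K" "\<And>x. x \<in> K \<Longrightarrow> inverse x \<in> K"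
  shows "subfield K complex_ring"
proof -
  interpret complex_ring: field complex_ring
    by (rule field_from_type_algebra)
  have 0: "0 \<in> K" using assms(2)[OF assms(1,1)] by simp
  have neg: "- x \<in> K" if "x \<in> K" for x using assms(2)[OF 0 that] by simp
  have add: "x + y \<in> K" if "x \<in> K" "y \<in> K" for x y
    using assms(2)[OF that(1) neg[OF that(2)]] by simp
  show ?thesis
    by (intro complex_ring.subfieldI' complex_ring.subringI)
      (use assms neg add in \<open>auto simp: complex_ring_simps complex_ring_uminus complex_ring_inv\<close>)
qed

context
  fixes z :: complex
begin

lemma rat_adjoin_generator: "z \<in> rat_adjoin z"
  unfolding rat_adjoin_def by (rule generate_field.incl) simp

lemma rat_adjoin_1: "1 \<in> rat_adjoin z"
  using generate_field.one[of complex_ring] by (simp add: rat_adjoin_def complex_ring_simps)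

lemma rat_adjoin_add: "x \<in> rat_adjoin z \<Longrightarrow> y \<in> rat_adjoin z \<Longrightarrow> x + y \<in> rat_adjoin z"
  using generate_field.eng_add[of x complex_ring] by (simp add: rat_adjoin_def complex_ring_simps)

lemma rat_adjoin_mult: "x \<in> rat_adjoin z \<Longrightarrow> y \<in> rat_adjoin z \<Longrightarrow> x * y \<in> rat_adjoin z"
  using generate_field.eng_mult[of x complex_ring] by (simp add: rat_adjoin_def complex_ring_simps)

lemma rat_adjoin_uminus: "x \<in> rat_adjoin z \<Longrightarrow> - x \<in> rat_adjoin z"
  using generate_field.a_inv[of x complex_ring] by (simp add: rat_adjoin_def complex_ring_uminus)

lemma rat_adjoin_0: "0 \<in> rat_adjoin z"
  using rat_adjoin_add[OF rat_adjoin_1 rat_adjoin_uminus[OF rat_adjoin_1]] by simp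

lemma rat_adjoin_inverse: "x \<in> rat_adjoin z \<Longrightarrow> inverse x \<in> rat_adjoin z"
  using generate_field.m_inv[of x complex_ring] rat_adjoin_0
  by (cases "x = 0") (simp_all add: rat_adjoin_def complex_ring_simps complex_ring_inv)

lemma rat_adjoin_divide: "x \<in> rat_adjoin z \<Longrightarrow> y \<in> rat_adjoin z \<Longrightarrow> x / y \<in> rat_adjoin z"
  by (simp add: divide_inverse rat_adjoin_mult rat_adjoin_inverse)

lemma rat_adjoin_power: "x \<in> rat_adjoin z \<Longrightarrow> x ^ n \<in> rat_adjoin z"
  by (induction n) (simp_all add: rat_adjoin_1 rat_adjoin_mult)

lemma rat_adjoin_of_nat: "of_nat n \<in> rat_adjoin z"
  by (induction n) (simp_all add: rat_adjoin_0 rat_adjoin_1 rat_adjoin_add)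

end

section \<open>Denominators in Q(w)\<close>

lemma subfield_Rats: "subfield \<rat> complex_ring"
  by (rule subfield_complex_ringI) auto

lemma algebraic_root_of_unity:
  assumes "0 < k" "w ^ k = 1"
  shows "(ring.algebraic complex_ring over \<rat>) w"
proof -
  interpret complex_ring: field complex_ring
    by (rule field_from_type_algebra)
  \<comment> \<open>Coefficient lists start with the leading coefficient, so \<open>1 # xs\<close>
    stands for X^k - 1.\<close>
  define xs where "xs = replicate (k - 1) 0 @ [- 1 :: complex]"
  have "complex_ring.eval (replicate n 0 @ [- 1]) w = - 1" for n
    by (induction n) (simp_all add: complex_ring_simps complex_ring_pow)
  then have "complex_ring.eval (1 # xs) w = 0"
    using assms by (simp add: xs_def complex_ring_simps complex_ring_pow)
  moreover have "1 # xs \<in> carrier (univ_poly complex_ring \<rat>)"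
    unfolding univ_poly_carrier[symmetric]
    by (rule complex_ring.polynomialI) (auto simp: xs_def complex_ring_simps)
  ultimately show ?thesis
    by (intro complex_ring.algebraicI[of "1 # xs"]) (simp_all add: complex_ring_simps)
qed

text \<open>As w is algebraic, the polynomial expressions Q[w] already form a field and hence
  contain Q(w). They are generated Horner style, so denominators can be cleared one coefficient at a
  time.\<close>

lemma rat_adjoin_fraction:
  assumes "0 < k" "w ^ k = 1" "x \<in> rat_adjoin w"
  shows "\<exists>N>0. of_nat N * x \<in> int_adjoin w"
proof -
  interpret complex_ring: field complex_ring
    by (rule field_from_type_algebra)
  let ?E = "complex_ring.simple_extension \<rat> w"
  have "subfield ?E complex_ring"
    using complex_ring.simple_extension_is_subfield[OF subfield_Rats, of w]
      algebraic_root_of_unity[OF assms(1,2)] by (simp add: complex_ring_simps)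
  moreover have "w \<in> ?E"
    using complex_ring.simple_extension_mem[OF subfieldE(1)[OF subfield_Rats], of w]
    by (simp add: complex_ring_simps)
  ultimately have "rat_adjoin w \<subseteq> ?E"
    unfolding rat_adjoin_def
    by (intro complex_ring.generate_field_min_subfield1) (auto simp: complex_ring_simps)
  with assms(3) have "x \<in> ?E" by blast
  then show ?thesis
  proof induction
    case zero
    show ?case by (auto intro!: exI[of _ 1] simp: complex_ring_simps int_adjoin_0)
  next
    case (lin a b)
    from lin obtain N where N: "N > 0" "of_nat N * a \<in> int_adjoin w" by blast
    from \<open>b \<in> \<rat>\<close> obtain r where r: "b = of_rat r" by (auto elim: Rats_cases)
    obtain c d where cd: "quotient_of r = (c, d)" by force
    have d: "d > 0" using quotient_of_denom_pos[OF cd] .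
    have b: "of_int d * b = of_int c"
      using quotient_of_div[OF cd] d unfolding r by (simp add: of_rat_divide)
    have "of_nat (N * nat d) * (a * w + b)
        = of_int d * ((of_nat N * a) * w) + of_nat N * (of_int d * b)"
      using d by (simp add: algebra_simps)
    also have "\<dots> \<in> int_adjoin w"
      unfolding b by (intro int_adjoin.intros int_adjoin_of_nat N)
    finally have "of_nat (N * nat d) * (a * w + b) \<in> int_adjoin w" .
    then show ?case using N d
      by (intro exI[of _ "N * nat d"]) (simp add: complex_ring_simps)
  qed
qed

section \<open>Powers of primitive roots of unity\<close>

lemma primitive_root_powers_inj:
  assumes "primitive_root_of_unity m z"
  shows "inj_on (\<lambda>i. z ^ i) {..<m}"
proof -
  have m: "z ^ m = 1" "\<And>j. 0 < j \<Longrightarrow> j < m \<Longrightarrow> z ^ j \<noteq> 1" "0 < m"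
    using assms by (auto simp: primitive_root_of_unity_def)
  have z: "z \<noteq> 0" using m by (auto simp: power_0_left)
  have "False" if "i < j" "j < m" "z ^ i = z ^ j" for i j
  proof -
    have "z ^ j = z ^ i * z ^ (j - i)" using that(1) by (simp flip: power_add)
    then have "z ^ (j - i) = 1" using that(3) z by simp
    then show False using m(2)[of "j - i"] that by simp
  qed
  then show ?thesis by (metis (no_types, lifting) inj_onI lessThan_iff linorder_neqE_nat)
qed

lemma prod_one_minus_primitive_root_powers:
  assumes "primitive_root_of_unity m z"
  shows "(\<Prod>i=1..<m. 1 - z ^ i) = of_nat m"
proof -
  let ?A = "(\<lambda>i. z ^ i) ` {1..<m}"
  let ?P = "\<Prod>i=1..<m. [:- (z ^ i), 1:]"
  let ?Q = "\<Sum>i<m. Polynomial.monom (1::complex) i"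
  have inj: "inj_on (\<lambda>i. z ^ i) {1..<m}"
    by (rule inj_on_subset[OF primitive_root_powers_inj[OF assms]]) auto
  have m: "0 < m" using assms by (simp add: primitive_root_of_unity_def)
  have degP: "Polynomial.degree ?P = m - 1"
    by (subst degree_prod_eq_sum_degree) auto
  have "Polynomial.lead_coeff ?P = 1"
    by (subst lead_coeff_prod) auto
  then have P: "poly.coeff ?P (m - 1) = 1" by (simp only: degP)
  have Q: "poly.coeff ?Q i = (if i < m then 1 else 0)" for i
    by (simp add: coeff_sum)
  \<comment> \<open>Both sides are (X^m - 1)/(X - 1): monic of degree m - 1 with the same m - 1
    distinct roots. Evaluation at 1 then gives the product.\<close>
  have "?P = ?Q"
  proof (rule poly_eqI_degree_lead_coeff[where n = "m - 1" and A = ?A])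
    show "poly.coeff ?P (m - 1) = poly.coeff ?Q (m - 1)" using m by (simp only: P Q) simp
    show "m - 1 \<le> card ?A" using card_image[OF inj] by simp
    show "Polynomial.degree ?P \<le> m - 1" by (simp only: degP)
    show "Polynomial.degree ?Q \<le> m - 1"
      by (rule Polynomial.degree_le) (use m in \<open>simp only: Q, auto\<close>)
    fix x assume "x \<in> ?A"
    then obtain i where i: "i \<in> {1..<m}" "x = z ^ i" by blast
    have "x ^ m = 1" unfolding i using assms
      by (metis mult.commute power_mult power_one primitive_root_of_unity_def)
    moreover have "x \<noteq> 1" using i assms by (auto simp: primitive_root_of_unity_def)
    ultimately have "poly ?Q x = 0"
      using power_diff_1_eq[of x m] by (simp add: poly_sum poly_monom)
    moreover have "poly ?P x = 0" using i by (auto simp: poly_prod)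
    ultimately show "poly ?P x = poly ?Q x" by simp
  qed
  then have "poly ?P 1 = poly ?Q 1" by simp
  then show ?thesis by (simp add: poly_prod poly_sum poly_monom)
qed

text \<open>Let \<open>q\<close> be a power of p that is 1 modulo k and divisible by \<open>p ^ a\<close>. Modulo p, the map
  \<open>v \<mapsto> v ^ q\<close> is the identity on the order generated by w but sends \<open>\<eta>\<close> to 1, so
  p divides \<open>1 - \<eta> ^ i\<close> up to a denominator prime to p. Multiplying over i, \<open>p ^ (p ^ a - 1)\<close>
  would divide \<open>p ^ a\<close>.\<close>

lemma prime_power_root_not_in_rat_adjoin:
  assumes k: "0 < k" "w ^ k = 1" and p: "prime p" "\<not> p dvd k"
    and eta: "primitive_root_of_unity (p ^ a) \<eta>" and gt2: "2 < p ^ a"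
  shows "\<eta> \<notin> rat_adjoin w"
proof
  assume "\<eta> \<in> rat_adjoin w"
  define m where "m = p ^ a"
  \<comment> \<open>By Euler's theorem the factor \<open>totient k\<close> yields
    \<open>w ^ q = w\<close>; the factor \<open>a\<close> makes \<open>p ^ a\<close> divide q, so
    that \<open>\<eta> ^ q = 1\<close>.\<close>
  define f where "f = totient k * a"
  define q where "q = p ^ f"
  have p1: "1 < p" using p(1) prime_gt_1_nat by blast
  have q: "0 < q" using p1 by (simp add: q_def)
  have em: "\<eta> ^ m = 1" using eta by (simp add: primitive_root_of_unity_def m_def)
  have "[p ^ totient k = 1] (mod k)"
    using euler_theorem[of p k] p by (simp add: prime_imp_coprime)
  then have "[q = 1] (mod k)"
    using cong_pow[of "p ^ totient k" 1 k a] by (simp add: q_def f_def power_mult)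
  then obtain c where c: "q = 1 + k * c"
    using q by (metis Suc_leI One_nat_def cong_to_1'_nat less_not_refl2 mult.commute add.commute add_0)
  have wq: "w ^ (p ^ f) = w"
    using k(2) by (simp add: q_def[symmetric] c power_add power_mult)
  have "m dvd q" unfolding m_def q_def f_def
    using k(1) by (intro le_imp_power_dvd) (simp add: Suc_le_eq)
  then have eq: "\<eta> ^ q = 1" using em by (auto simp: power_mult elim!: dvdE)

  \<comment> \<open>Leastness makes the denominator prime to p: if p divided N, it would divide
    \<open>v ^ q = of_nat N ^ q\<close>, hence v, and N/p would be a smaller denominator.\<close>
  define N where "N = (LEAST N. 0 < N \<and> of_nat N * \<eta> \<in> int_adjoin w)"
  have N: "0 < N" "of_nat N * \<eta> \<in> int_adjoin w"
    using LeastI_ex[OF rat_adjoin_fraction[OF k \<open>\<eta> \<in> rat_adjoin w\<close>]] by (auto simp: N_def)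
  define v where "v = of_nat N * \<eta>"
  have v: "v \<in> int_adjoin w" using N by (simp add: v_def)
  have vq: "v ^ q = of_nat N ^ q" by (simp add: v_def power_mult_distrib eq)
  have pN: "\<not> p dvd N"
  proof
    assume "p dvd N"
    then obtain N' where N': "N = p * N'" by blast
    have "of_nat N ^ q = of_nat p * (of_nat (N' * N ^ (q - 1)) :: complex)"
      using q by (cases q) (simp_all add: N')
    then have "int_adjoin_multiple w p (v ^ (p ^ f))"
      unfolding q_def[symmetric] vq by (metis int_adjoin_multipleI int_adjoin_of_nat)
    then have "int_adjoin_multiple w p v"
      by (rule int_adjoin_reduced[OF p(1) wq v])
    then obtain u where u: "u \<in> int_adjoin w" "v = of_nat p * u"
      by (auto simp: int_adjoin_multiple_def)
    have "of_nat N' * \<eta> = u" using u(2) p1 by (simp add: v_def N')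
    then have "N \<le> N'"
      unfolding N_def using N(1) N' u(1) by (intro Least_le) simp
    then show False using N(1) N' p1 by simp
  qed
  \<comment> \<open>The q-th power map fixes both N and v modulo p, and their q-th powers coincide,
    so v and N are congruent.\<close>
  have "int_adjoin_multiple w p ((of_nat N ^ (p ^ f) - of_nat N) - (v ^ (p ^ f) - v))"
    by (intro int_adjoin_multiple_diff int_adjoin_frobenius p wq v int_adjoin_of_nat)
  then have vN: "int_adjoin_multiple w p (v - of_nat N)"
    by (simp add: q_def[symmetric] vq)
  have pow: "int_adjoin_multiple w p (v ^ i - of_nat N ^ i)" for i
  proof (induction i)
    case (Suc i)
    have "v ^ Suc i - of_nat N ^ Suc i
        = v * (v ^ i - of_nat N ^ i) + of_nat N ^ i * (v - of_nat N)"
      by (simp add: algebra_simps)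
    then show ?case
      by (simp only:) (intro int_adjoin_multiple_add int_adjoin_multiple_mult Suc vN v
          int_adjoin_power int_adjoin_of_nat)
  qed (simp add: int_adjoin_multiple_0)
  \<comment> \<open>The factor \<open>of_nat N ^ m\<close> clears the denominators of all
    \<open>\<eta> ^ i\<close> with \<open>i < m\<close> at once.\<close>
  have "int_adjoin_multiple w p (of_nat N ^ m * (1 - \<eta> ^ i))" if "i < m" for i
  proof -
    have "of_nat N ^ m * (1 - \<eta> ^ i) = - (of_nat N ^ (m - i) * (v ^ i - of_nat N ^ i))"
      using that by (simp add: v_def power_mult_distrib algebra_simps flip: power_add)
    then show ?thesis
      by (simp only:) (intro int_adjoin_multiple_uminus int_adjoin_multiple_mult pow
          int_adjoin_power int_adjoin_of_nat)
  qed
  then have "\<forall>i. \<exists>u. i < m \<longrightarrow> u \<in> int_adjoin w \<and> of_nat N ^ m * (1 - \<eta> ^ i) = of_nat p * u"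
    unfolding int_adjoin_multiple_def by blast
  then obtain u where u: "\<And>i. i < m \<Longrightarrow> u i \<in> int_adjoin w"
    "\<And>i. i < m \<Longrightarrow> of_nat N ^ m * (1 - \<eta> ^ i) = of_nat p * u i" by metis
  have prod_u: "prod u {1..<n} \<in> int_adjoin w" if "n \<le> m" for n
    using that by (induction n) (auto simp: int_adjoin_1 prod.atLeastLessThan_Suc intro!: int_adjoin.mult u)
  \<comment> \<open>Here \<open>2 < p ^ a\<close> enters: the product supplies m - 1 factors p, and
    a + 1 are needed so that one survives the cancellation of \<open>m = p ^ a\<close>.\<close>
  have "Suc a < 2 ^ a \<or> a < 2"
    by (induction a) (auto simp: less_Suc_eq numeral_2_eq_2)
  moreover have "2 ^ a \<le> p ^ a" using p1 by (simp add: power_mono)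
  ultimately have am: "a + 1 \<le> m - 1"
    using gt2 by (auto simp: m_def less_2_cases_iff)
  define K where "K = m * (m - 1)"
  have "of_nat (N ^ K) * of_nat m
      = (\<Prod>i=1..<m. of_nat N ^ m * (1 - \<eta> ^ i))"
    unfolding prod.distrib prod_one_minus_primitive_root_powers[OF eta[folded m_def]]
    by (simp add: K_def power_mult)
  also have "\<dots> = (\<Prod>i=1..<m. of_nat p * u i)"
    by (rule prod.cong) (auto simp: u)
  also have "\<dots> = of_nat p ^ (m - 1) * prod u {1..<m}"
    by (simp add: prod.distrib)
  also have "(m - 1) = a + Suc (m - 1 - Suc a)" using am by simp
  also have "of_nat p ^ (a + Suc (m - 1 - Suc a)) * prod u {1..<m}
      = of_nat p * (of_nat p ^ (m - 1 - Suc a) * prod u {1..<m}) * of_nat m"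
    by (simp add: m_def power_add)
  finally have "of_nat (N ^ K)
      = of_nat p * (of_nat p ^ (m - 1 - Suc a) * prod u {1..<m})"
    using p1 unfolding m_def by simp
  also have "int_adjoin_multiple w p \<dots>"
    by (intro int_adjoin_multipleI int_adjoin.mult prod_u int_adjoin_power int_adjoin_of_nat order.refl)
  finally have "int_adjoin_multiple w p (of_int (int (N ^ K)))" by simp
  then have "p dvd N ^ K"
    using int_adjoin_multiple_of_int_dvd[OF k p(1)] int_dvd_int_iff by blast
  then show False using pN p(1) prime_dvd_power by blast
qed

text \<open>If 4 does not divide n, the odd part of n is n or n/2 and exceeds 1, so it has an odd
  prime factor; otherwise 4 itself serves.\<close>

lemma exists_prime_power_gt_2_dvd:
  fixes n :: nat
  assumes "4 \<le> n"
  obtains p a where "prime p" "2 < p ^ a" "p ^ a dvd n" "p dvd n"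
proof (cases "4 dvd n")
  case True
  then have "2 ^ 2 dvd n" "2 dvd n" by (auto intro: dvd_trans)
  with that[of 2 2] show ?thesis by simp
next
  case False
  define l where "l = (if even n then n div 2 else n)"
  have l: "odd l" "l dvd n" "l \<noteq> 1" using False assms by (auto simp: l_def elim!: evenE)
  obtain p where p: "prime p" "p dvd l" using prime_factor_nat[OF l(3)] by blast
  have "p \<noteq> 2" using p l by auto
  then have "2 < p" using prime_ge_2_nat[OF p(1)] by simp
  then show ?thesis using that[of p 1] p l by (auto intro: dvd_trans)
qed

lemma primitive_root_power:
  assumes "primitive_root_of_unity (m * n) z"
  shows "primitive_root_of_unity m (z ^ n)"
  using assms by (auto simp: primitive_root_of_unity_def power_mult[symmetric] mult.commute)

text \<open>A prime dividing k + 1 does not divide k. A suitable power of z has prime power order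
  above 2, and the preceding obstruction keeps it out of Q(w).\<close>

theorem next_primitive_root_not_in_rat_adjoin:
  assumes "3 \<le> k" "w ^ k = 1" "primitive_root_of_unity (k + 1) z"
  shows "z \<notin> rat_adjoin w"
proof
  assume z: "z \<in> rat_adjoin w"
  obtain p a where pa: "prime p" "2 < p ^ a" "p ^ a dvd k + 1" "p dvd k + 1"
    using exists_prime_power_gt_2_dvd[of "k + 1"] assms(1) by auto
  then obtain n where n: "k + 1 = p ^ a * n" by blast
  have "\<not> p dvd k"
  proof
    assume "p dvd k"
    then have "p dvd 1" using pa(4) by (simp only: dvd_add_right_iff)
    then show False using pa(1) by simp
  qed
  moreover have "primitive_root_of_unity (p ^ a) (z ^ n)"
    using assms(3) unfolding n by (rule primitive_root_power)
  ultimately have "z ^ n \<notin> rat_adjoin w"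
    using prime_power_root_not_in_rat_adjoin[of k w p a "z ^ n"] assms pa by simp
  then show False using rat_adjoin_power[OF z] by blast
qed

section \<open>Representations and quadrature rules\<close>

lemma linear_form_power:
  "(const2 a * var_x + const2 b * var_y) ^ d
     = (\<Sum>i\<le>d. const2 (of_nat (d choose i) * a ^ (d - i) * b ^ i) * (var_x ^ (d - i) * var_y ^ i))"
proof -
  have mult: "const2 x * const2 y = const2 (x * y)" for x y by (simp add: const2_def)
  have pow: "const2 x ^ n = const2 (x ^ n)" for x n
    by (induction n) (simp_all add: mult, simp add: const2_def one_pCons)
  have nat: "of_nat n = const2 (of_nat n)" for n
    by (simp add: const2_def of_nat_poly)
  \<comment> \<open>The summands are swapped because \<open>binomial_ring\<close> puts the running
    exponent on the first one.\<close>
  have "(const2 b * var_y + const2 a * var_x) ^ d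
     = (\<Sum>i\<le>d. const2 (of_nat (d choose i) * a ^ (d - i) * b ^ i) * (var_x ^ (d - i) * var_y ^ i))"
    unfolding binomial_ring
    by (rule sum.cong) (simp_all add: power_mult_distrib pow nat mult[symmetric] algebra_simps)
  then show ?thesis by (simp add: add.commute)
qed

lemma power_sum_expand:
  "(\<Sum>j\<in>J. const2 (l j) * (const2 (a j) * var_x + const2 (b j) * var_y) ^ d)
     = (\<Sum>i\<le>d. const2 (of_nat (d choose i) * (\<Sum>j\<in>J. l j * a j ^ (d - i) * b j ^ i))
          * (var_x ^ (d - i) * var_y ^ i))"
proof -
  have mult: "const2 x * const2 y = const2 (x * y)" for x y by (simp add: const2_def)
  have sum: "const2 (sum f J) = (\<Sum>j\<in>J. const2 (f j))" for f
  proof (induction J rule: infinite_finite_induct)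
    case (insert x F)
    have "const2 (u + v) = const2 u + const2 v" for u v by (simp add: const2_def)
    with insert show ?case by simp
  qed (simp_all add: const2_def)
  show ?thesis
    unfolding linear_form_power sum_distrib_left sum_distrib_right sum
    by (subst sum.swap) (simp add: mult[symmetric] mult_ac)
qed

text \<open>In C[x][y] the outer coefficient index is the exponent of y, the inner one that of
  x.\<close>

lemma coeff_monomial:
  "poly.coeff (poly.coeff (const2 c * (var_x ^ m * var_y ^ n)) i) j
     = (if i = n \<and> j = m then c else 0)"
proof -
  have x: "var_x ^ m = [:Polynomial.monom 1 m:]"
    by (induction m) (simp_all add: var_x_def one_pCons monom_Suc)
  have y: "var_y ^ n = Polynomial.monom 1 n"
    by (induction n) (simp_all add: var_y_def monom_Suc)
  show ?thesis unfolding x y by (simp add: const2_def smult_monom)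
qed

text \<open>Comparing coefficients and dividing by the nonzero \<open>2 * k choose i\<close> turns a
  representation into conditions on weighted moments.\<close>

lemma power_sum_rep_moments:
  assumes "has_power_sum_rep K (2 * k) (var_x ^ k * var_y ^ k) r"
  obtains l a b where "\<forall>j\<in>{1..r}. l j \<in> K \<and> a j \<in> K \<and> b j \<in> K"
    "\<forall>i\<le>2*k. (\<Sum>j=1..r. l j * a j ^ (2 * k - i) * b j ^ i)
       = (if i = k then 1 / of_nat (2 * k choose k) else 0)"
proof -
  obtain l a b where K: "\<forall>j\<in>{1..r}. l j \<in> K \<and> a j \<in> K \<and> b j \<in> K"
    and rep: "var_x ^ k * var_y ^ k
      = (\<Sum>j=1..r. const2 (l j) * (const2 (a j) * var_x + const2 (b j) * var_y) ^ (2 * k))"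
    using assms unfolding has_power_sum_rep_def by blast
  define M where "M i = (\<Sum>j=1..r. l j * a j ^ (2 * k - i) * b j ^ i)" for i
  have "const2 1 * (var_x ^ k * var_y ^ k)
      = (\<Sum>i\<le>2*k. const2 (of_nat (2 * k choose i) * M i) * (var_x ^ (2 * k - i) * var_y ^ i))"
    using rep unfolding power_sum_expand M_def by (simp add: const2_def flip: one_pCons)
  note eq = arg_cong[OF this, of "\<lambda>p. poly.coeff (poly.coeff p i) (2 * k - i)" for i]
  have "M i = (if i = k then 1 / of_nat (2 * k choose k) else 0)" if i: "i \<le> 2 * k" for i
  proof -
    have "(if i = k \<and> 2 * k - i = k then 1 else 0)
        = (\<Sum>n\<le>2*k. if i = n \<and> 2 * k - i = 2 * k - n then of_nat (2 * k choose n) * M n else 0)"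
      using eq[of i] unfolding coeff_sum coeff_monomial .
    also have "\<dots> = (\<Sum>n\<le>2*k. if i = n then of_nat (2 * k choose n) * M n else 0)"
      by (rule sum.cong) auto
    also have "\<dots> = of_nat (2 * k choose i) * M i" using i by simp
    finally have "(if i = k \<and> 2 * k - i = k then 1 else 0) = of_nat (2 * k choose i) * M i" .
    moreover have "(of_nat (2 * k choose i) :: complex) \<noteq> 0" using i by simp
    ultimately show ?thesis by (auto simp: field_simps split: if_splits)
  qed
  then show ?thesis using that[of l a b] K unfolding M_def by blast
qed

text \<open>The converse passage from moments to a representation. An arbitrary index set allows
  summands to be indexed by real nodes.\<close>

lemma power_sum_repI:
  fixes l a b :: "'i \<Rightarrow> complex"
  assumes "finite J" "card J = r" "\<And>j. j \<in> J \<Longrightarrow> l j \<in> K \<and> a j \<in> K \<and> b j \<in> K"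
    and moments: "\<And>i. i \<le> 2 * k \<Longrightarrow> (\<Sum>j\<in>J. l j * a j ^ (2 * k - i) * b j ^ i)
       = (if i = k then 1 / of_nat (2 * k choose k) else 0)"
  shows "has_power_sum_rep K (2 * k) (var_x ^ k * var_y ^ k) r"
proof -
  obtain h where h: "bij_betw h {1..r} J"
    using ex_bij_betw_nat_finite_1[OF assms(1)] assms(2) by blast
  have "(\<Sum>j\<in>J. const2 (l j) * (const2 (a j) * var_x + const2 (b j) * var_y) ^ (2 * k))
     = (\<Sum>i\<le>2*k. if i = k then var_x ^ k * var_y ^ k else 0)"
    unfolding power_sum_expand by (rule sum.cong) (auto simp: moments const2_def one_pCons[symmetric])
  then have "var_x ^ k * var_y ^ k
     = (\<Sum>j\<in>J. const2 (l j) * (const2 (a j) * var_x + const2 (b j) * var_y) ^ (2 * k))" by simp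
  also have "\<dots> = (\<Sum>j=1..r. const2 (l (h j))
      * (const2 (a (h j)) * var_x + const2 (b (h j)) * var_y) ^ (2 * k))"
    by (rule sum.reindex_bij_betw[OF h, symmetric])
  finally show ?thesis
    unfolding has_power_sum_rep_def using bij_betwE[OF h] assms(3)
    by (intro exI[of _ "l \<circ> h"] exI[of _ "a \<circ> h"] exI[of _ "b \<circ> h"]) simp
qed

lemma form_length_eqI:
  assumes "has_power_sum_rep K d f r" "\<And>s. has_power_sum_rep K d f s \<Longrightarrow> r \<le> s"
  shows "form_length K d f = enat r"
  unfolding form_length_def
  by (rule antisym) (use assms in \<open>auto intro: INF_lower2 INF_greatest\<close>)

text \<open>Dehomogenisation: the linear forms with a nonzero coefficient at x become the
  nodes of a quadrature rule in the slope; those proportional to y only affect the top moment.\<close>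

lemma power_sum_rep_nodes:
  assumes "has_power_sum_rep K (2 * k) (var_x ^ k * var_y ^ k) r"
    and "0 < k" "\<And>x y. x \<in> K \<Longrightarrow> y \<in> K \<Longrightarrow> x / y \<in> K"
  obtains T \<mu> D where "finite T" "T \<subseteq> K" "D \<le> 2 * k" "card T + 2 * k \<le> r + D"
    "\<forall>i\<le>D. (\<Sum>s\<in>T. \<mu> s * s ^ i) = (if i = k then 1 / of_nat (2 * k choose k) else 0)"
    "2 * k \<le> D + 1"
proof -
  obtain l a b where K: "\<forall>j\<in>{1..r}. l j \<in> K \<and> a j \<in> K \<and> b j \<in> K"
    and mom: "\<forall>i\<le>2*k. (\<Sum>j=1..r. l j * a j ^ (2 * k - i) * b j ^ i)
       = (if i = k then 1 / of_nat (2 * k choose k) else 0)"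
    by (rule power_sum_rep_moments[OF assms(1)])
  define J where "J = {j\<in>{1..r}. a j \<noteq> 0}"
  define s where "s j = b j / a j" for j
  define T where "T = s ` J"
  \<comment> \<open>Proportional forms share a slope, so their weights are collected at one
    node.\<close>
  define \<mu> where "\<mu> t = (\<Sum>j\<in>{j\<in>J. s j = t}. l j * a j ^ (2 * k))" for t
  \<comment> \<open>If some form lacks x, moment 2k is given up, but there is also one node less to
    count, so \<open>card T + 2 * k \<le> r + D\<close> holds in both cases.\<close>
  define D where "D = (if J = {1..r} then 2 * k else 2 * k - 1)"
  have J: "finite J" "J \<subseteq> {1..r}" by (auto simp: J_def)
  have sub: "T \<subseteq> K" using K assms(3) by (auto simp: T_def s_def J_def)
  have "card T \<le> card J" unfolding T_def by (rule card_image_le[OF J(1)])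
  moreover have "card J \<le> r" using card_mono[OF _ J(2)] by simp
  moreover have "card J < r" if "J \<noteq> {1..r}"
    using psubset_card_mono[of "{1..r}" J] J(2) that by auto
  ultimately have card: "card T + 2 * k \<le> r + D"
    using assms(2) by (cases "J = {1..r}") (simp_all add: D_def)
  have "(\<Sum>t\<in>T. \<mu> t * t ^ i) = (if i = k then 1 / of_nat (2 * k choose k) else 0)"
    if i: "i \<le> D" for i
  proof -
    have "D \<le> 2 * k" by (simp add: D_def)
    with i have i2: "i \<le> 2 * k" by simp
    have "(\<Sum>t\<in>T. \<mu> t * t ^ i) = (\<Sum>t\<in>T. \<Sum>j\<in>{j\<in>J. s j = t}. l j * a j ^ (2 * k) * s j ^ i)"
      unfolding \<mu>_def sum_distrib_right by (intro sum.cong) auto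
    also have "\<dots> = (\<Sum>j\<in>J. l j * a j ^ (2 * k) * s j ^ i)"
      unfolding T_def by (rule sum.image_gen[OF J(1), symmetric])
    also have "\<dots> = (\<Sum>j\<in>J. l j * a j ^ (2 * k - i) * b j ^ i)"
    proof (rule sum.cong[OF refl])
      fix j assume "j \<in> J"
      then have "a j \<noteq> 0" by (simp add: J_def)
      then have "a j ^ (2 * k) * s j ^ i = a j ^ (2 * k - i) * b j ^ i"
        using i2 by (simp add: s_def power_divide power_diff)
      then show "l j * a j ^ (2 * k) * s j ^ i = l j * a j ^ (2 * k - i) * b j ^ i"
        by (simp only: mult.assoc)
    qed
    also have "\<dots> = (\<Sum>j=1..r. l j * a j ^ (2 * k - i) * b j ^ i)"
    proof (rule sum.mono_neutral_left[OF _ J(2)])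
      show "\<forall>j\<in>{1..r} - J. l j * a j ^ (2 * k - i) * b j ^ i = 0"
      proof
        fix j assume j: "j \<in> {1..r} - J"
        then have "J \<noteq> {1..r}" by blast
        then have "i < 2 * k" using i assms(2) by (simp add: D_def)
        moreover have "a j = 0" using j by (simp add: J_def)
        ultimately show "l j * a j ^ (2 * k - i) * b j ^ i = 0" by simp
      qed
    qed simp
    finally show ?thesis using mom[rule_format, OF i2] by simp
  qed
  moreover have "finite T" using J(1) by (simp add: T_def)
  moreover have "D \<le> 2 * k" "2 * k \<le> D + 1" by (auto simp: D_def)
  ultimately show ?thesis using that[of T D \<mu>] sub card by blast
qed

section \<open>Apolarity and the node polynomial\<close>

lemma node_polynomial_coeff_zero:
  fixes \<mu> :: "'a::field \<Rightarrow> 'a"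
  assumes "finite T" "c \<noteq> 0"
    "\<And>i. i \<le> D \<Longrightarrow> (\<Sum>s\<in>T. \<mu> s * s ^ i) = (if i = k then c else 0)"
    and "i + card T \<le> D" "i \<le> k"
  shows "poly.coeff (\<Prod>s\<in>T. [:- s, 1:]) (k - i) = 0"
proof -
  let ?h = "\<Prod>s\<in>T. [:- s, 1:]"
  have deg: "Polynomial.degree ?h = card T" by (subst degree_prod_eq_sum_degree) auto
  \<comment> \<open>X^i times \<open>?h\<close> vanishes at every node. Expanding it gives moments
    of degree at most \<open>i + card T \<le> D\<close>, of which only the k-th is nonzero.\<close>
  have "0 = (\<Sum>s\<in>T. \<mu> s * s ^ i * poly ?h s)"
    using assms(1) by (intro sum.neutral[symmetric]) (auto simp: poly_prod)
  also have "\<dots> = (\<Sum>s\<in>T. \<Sum>t\<le>card T. poly.coeff ?h t * (\<mu> s * s ^ (i + t)))"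
    unfolding poly_altdef deg sum_distrib_left by (simp add: power_add mult_ac)
  also have "\<dots> = (\<Sum>t\<le>card T. poly.coeff ?h t * (\<Sum>s\<in>T. \<mu> s * s ^ (i + t)))"
    by (subst sum.swap) (simp add: sum_distrib_left)
  also have "\<dots> = (\<Sum>t\<le>card T. if t = k - i then poly.coeff ?h t * c else 0)"
    using assms(4,5) by (intro sum.cong) (auto simp: assms(3))
  also have "\<dots> = poly.coeff ?h (k - i) * c"
    using coeff_eq_0[of ?h "k - i"] deg by (auto simp: not_le)
  finally show ?thesis using assms(2) by simp
qed

lemma node_polynomial_lead_coeff:
  fixes T :: "'a::field set"
  shows "poly.coeff (\<Prod>s\<in>T. [:- s, 1:]) (card T) = 1"
proof -
  have "Polynomial.degree (\<Prod>s\<in>T. [:- s, 1:]) = card T"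
    by (subst degree_prod_eq_sum_degree) auto
  moreover have "Polynomial.lead_coeff (\<Prod>s\<in>T. [:- s, 1:]) = 1"
    by (subst lead_coeff_prod) auto
  ultimately show ?thesis by simp
qed

lemma card_nodes_gt:
  fixes \<mu> :: "'a::field \<Rightarrow> 'a"
  assumes "finite T" "c \<noteq> 0" "k \<le> D"
    "\<And>i. i \<le> D \<Longrightarrow> (\<Sum>s\<in>T. \<mu> s * s ^ i) = (if i = k then c else 0)"
  shows "k < card T"
proof (rule ccontr)
  assume "\<not> k < card T"
  \<comment> \<open>The shift \<open>k - card T\<close> aims at the coefficient of index
    \<open>card T\<close>, the leading one.\<close>
  then have "poly.coeff (\<Prod>s\<in>T. [:- s, 1:]) (k - (k - card T)) = 0"
    using assms by (intro node_polynomial_coeff_zero[where D = D and c = c and \<mu> = \<mu>]) auto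
  then show False using node_polynomial_lead_coeff[of T] \<open>\<not> k < card T\<close> by simp
qed

lemma power_sum_rep_ge:
  assumes "has_power_sum_rep K (2 * k) (var_x ^ k * var_y ^ k) r"
    and "0 < k" "\<And>x y. x \<in> K \<Longrightarrow> y \<in> K \<Longrightarrow> x / y \<in> K"
  shows "k + 1 \<le> r"
proof -
  obtain T \<mu> D where T: "finite T" "T \<subseteq> K" "D \<le> 2 * k" "card T + 2 * k \<le> r + D"
    "\<forall>i\<le>D. (\<Sum>s\<in>T. \<mu> s * s ^ i) = (if i = k then 1 / of_nat (2 * k choose k) else 0)"
    "2 * k \<le> D + 1"
    by (rule power_sum_rep_nodes[OF assms])
  have "k < card T" by (rule card_nodes_gt[OF T(1) _ _ T(5)[rule_format]]) (use T assms(2) in auto)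
  then show ?thesis using T by simp
qed

lemma minimal_rep_contains_roots_of_unity:
  assumes "has_power_sum_rep K (2 * k) (var_x ^ k * var_y ^ k) (k + 1)"
    and "0 < k" "\<And>x y. x \<in> K \<Longrightarrow> y \<in> K \<Longrightarrow> x / y \<in> K" and "z ^ (k + 1) = 1"
  shows "z \<in> K"
proof -
  obtain T \<mu> D where T: "finite T" "T \<subseteq> K" "D \<le> 2 * k" "card T + 2 * k \<le> (k + 1) + D"
    "\<forall>i\<le>D. (\<Sum>s\<in>T. \<mu> s * s ^ i) = (if i = k then 1 / of_nat (2 * k choose k) else 0)"
    "2 * k \<le> D + 1"
    by (rule power_sum_rep_nodes[OF assms(1-3)])
  have "k < card T" by (rule card_nodes_gt[OF T(1) _ _ T(5)[rule_format]]) (use T assms(2) in auto)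
  \<comment> \<open>The counting bounds are tight: k + 1 forms must give k + 1 distinct nodes and
    keep all moments up to 2k.\<close>
  with T have card: "card T = k + 1" and D: "D = 2 * k" by auto
  let ?h = "\<Prod>s\<in>T. [:- s, 1:]"
  define c where "c = poly.coeff ?h 0"
  have deg: "Polynomial.degree ?h = k + 1"
    by (subst degree_prod_eq_sum_degree) (auto simp: card)
  have "?h = Polynomial.monom 1 (k + 1) + [:c:]"
  proof (rule poly_eqI)
    fix i
    consider "i = 0" | "0 < i" "i \<le> k" | "i = k + 1" | "k + 1 < i" by linarith
    then show "poly.coeff ?h i = poly.coeff (Polynomial.monom 1 (k + 1) + [:c:]) i"
    proof cases
      case 2
      \<comment> \<open>The shift \<open>k - i\<close> is admissible because
        \<open>(k - i) + (k + 1) \<le> 2 * k\<close> for \<open>i \<ge> 1\<close>.\<close>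
      have "poly.coeff ?h (k - (k - i)) = 0"
        by (rule node_polynomial_coeff_zero[OF T(1) _ T(5)[rule_format]]) (use 2 D card in auto)
      with 2 show ?thesis by (simp add: coeff_pCons split: nat.splits)
    next
      case 3
      then show ?thesis
        using node_polynomial_lead_coeff[of T] card by simp
    next
      case 4
      then show ?thesis using deg by (simp add: coeff_eq_0 coeff_pCons split: nat.splits)
    qed (simp add: c_def)
  qed
  moreover have root: "poly ?h s = 0 \<longleftrightarrow> s \<in> T" for s
    using T(1) by (simp add: poly_prod)
  ultimately have iff: "s \<in> T \<longleftrightarrow> s ^ (k + 1) = - c" for s
    by (simp add: poly_monom add_eq_0_iff2)
  \<comment> \<open>For a nonzero node s, \<open>z * s\<close> is again a root of X^(k+1) + c, so z
    is a quotient of two nodes in K.\<close>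
  have "\<not> T \<subseteq> {0}"
  proof
    assume "T \<subseteq> {0}"
    then have "card T \<le> 1" using card_mono[of "{0}" T] by simp
    then show False using card assms(2) by simp
  qed
  then obtain s where s: "s \<in> T" "s \<noteq> 0" by blast
  then have "z * s \<in> T" using iff assms(4) by (simp only: power_mult_distrib) simp
  then have "(z * s) / s \<in> K" using s(1) T(2) assms(3) by blast
  then show ?thesis using s(2) by simp
qed

section \<open>Explicit representations over cyclotomic fields\<close>

lemma sum_powers_root_of_unity:
  assumes "primitive_root_of_unity m z"
  shows "(\<Sum>j<m. (z ^ j) ^ i) = (if m dvd i then of_nat m else 0)"
proof (cases "m dvd i")
  case True
  have "(z ^ j) ^ i = 1" for j
    using True assms
    by (auto simp: primitive_root_of_unity_def mult.commute mult.left_commute power_mult[symmetric]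
        elim!: dvdE) (metis mult.commute power_mult power_one)
  then show ?thesis using True by simp
next
  case False
  have m: "0 < m" "z ^ m = 1" using assms by (auto simp: primitive_root_of_unity_def)
  have "z ^ i = z ^ (m * (i div m) + i mod m)" by simp
  also have "\<dots> = z ^ (i mod m)" by (simp only: power_add power_mult m) simp
  finally have "z ^ i \<noteq> 1"
    using assms False m(1) by (auto simp: primitive_root_of_unity_def mod_greater_zero_iff_not_dvd)
  moreover have "(z ^ i) ^ m = 1" using m(2) by (metis mult.commute power_mult power_one)
  ultimately have "(\<Sum>j<m. (z ^ i) ^ j) = 0"
    using power_diff_1_eq[of "z ^ i" m] by simp
  then show ?thesis using False by (simp add: power_mult[symmetric] mult.commute)
qed

text \<open>The nodes are the (k+1)-th roots of unity. The factor \<open>z ^ j\<close> in the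
  weights shifts exponents by one, so the Fourier sum tests \<open>k + 1 dvd i + 1\<close>, which
  for \<open>i \<le> 2 * k\<close> singles out \<open>i = k\<close>.\<close>

lemma power_sum_rep_primitive_succ:
  assumes "primitive_root_of_unity (k + 1) z"
  shows "has_power_sum_rep (rat_adjoin z) (2 * k) (var_x ^ k * var_y ^ k) (k + 1)"
proof (rule power_sum_repI)
  let ?C = "of_nat (k + 1) * of_nat (2 * k choose k) :: complex"
  show "finite {..<k + 1}" "card {..<k + 1} = k + 1" by simp_all
  show "z ^ j / ?C \<in> rat_adjoin z \<and> 1 \<in> rat_adjoin z \<and> z ^ j \<in> rat_adjoin z" for j
    by (intro conjI rat_adjoin_divide rat_adjoin_power rat_adjoin_mult rat_adjoin_of_nat
        rat_adjoin_1 rat_adjoin_generator)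
  fix i assume i: "i \<le> 2 * k"
  have "k + 1 dvd i + 1 \<longleftrightarrow> i = k"
  proof
    assume "k + 1 dvd i + 1"
    then obtain c where c: "i + 1 = (k + 1) * c" by blast
    have "c < 2"
    proof (rule ccontr)
      assume "\<not> c < 2"
      then have "(k + 1) * 2 \<le> (k + 1) * c" by (intro mult_left_mono) auto
      then show False using c i by simp
    qed
    moreover have "c \<noteq> 0" using c by (intro notI) simp
    ultimately have "c = 1" by simp
    then show "i = k" using c by simp
  qed simp
  then have "(\<Sum>j<k + 1. (z ^ j) ^ (i + 1)) = (if i = k then of_nat (k + 1) else 0)"
    unfolding sum_powers_root_of_unity[OF assms] by simp
  moreover have "(\<Sum>j<k + 1. z ^ j / ?C * 1 ^ (2 * k - i) * (z ^ j) ^ i)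
      = (\<Sum>j<k + 1. (z ^ j) ^ (i + 1)) / ?C"
    unfolding sum_divide_distrib by (rule sum.cong) simp_all
  ultimately show "(\<Sum>j<k + 1. z ^ j / ?C * 1 ^ (2 * k - i) * (z ^ j) ^ i)
      = (if i = k then 1 / of_nat (2 * k choose k) else 0)"
    by (simp only:) (simp del: of_nat_add of_nat_Suc)
qed

text \<open>Equal weights at the k-th roots of unity pick out the moments 0, k and 2k. The forms x
  (index k) and y (index k + 1), with negative weight, cancel the moments 0 and 2k.\<close>

lemma power_sum_rep_primitive:
  assumes "primitive_root_of_unity k w"
  shows "has_power_sum_rep (rat_adjoin w) (2 * k) (var_x ^ k * var_y ^ k) (k + 2)"
proof (rule power_sum_repI)
  let ?C = "of_nat (2 * k choose k) :: complex"
  let ?l = "\<lambda>j. if j < k then 1 / (of_nat k * ?C) else - (1 / ?C)"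
  let ?a = "\<lambda>j. if j = k + 1 then 0 else 1 :: complex"
  let ?b = "\<lambda>j. if j < k then w ^ j else if j = k then 0 else 1"
  have k: "0 < k" using assms by (simp add: primitive_root_of_unity_def)
  show "finite {..<k + 2}" "card {..<k + 2} = k + 2" by simp_all
  show "?l j \<in> rat_adjoin w \<and> ?a j \<in> rat_adjoin w \<and> ?b j \<in> rat_adjoin w" for j
    by (auto intro!: rat_adjoin_uminus rat_adjoin_divide rat_adjoin_power rat_adjoin_mult
        rat_adjoin_of_nat rat_adjoin_0 rat_adjoin_1 rat_adjoin_generator)
  fix i assume i: "i \<le> 2 * k"
  have dvd: "k dvd i \<longleftrightarrow> i = 0 \<or> i = k \<or> i = 2 * k"
  proof
    assume "k dvd i"
    then obtain c where c: "i = k * c" by blast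
    have "c \<le> 2" using i k by (simp add: c mult.commute)
    then consider "c = 0" | "c = 1" | "c = 2" by linarith
    then show "i = 0 \<or> i = k \<or> i = 2 * k" by cases (simp_all add: c)
  qed auto
  have "(\<Sum>j<k + 2. ?l j * ?a j ^ (2 * k - i) * ?b j ^ i)
      = (\<Sum>j<k. (w ^ j) ^ i) / (of_nat k * ?C) - 0 ^ i / ?C - 0 ^ (2 * k - i) / ?C"
    unfolding sum_divide_distrib by (simp add: numeral_2_eq_2)
  also have "\<dots> = (if i = k then 1 / ?C else 0)"
    unfolding sum_powers_root_of_unity[OF assms] dvd using i k by (auto simp: power_0_left)
  finally show "(\<Sum>j<k + 2. ?l j * ?a j ^ (2 * k - i) * ?b j ^ i)
      = (if i = k then 1 / of_nat (2 * k choose k) else 0)" .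
qed

section \<open>Real representations\<close>

lemma card_le_separating:
  fixes A B :: "'a::linorder set"
  assumes "finite A" "finite B" "\<And>a b. a \<in> A \<Longrightarrow> b \<in> A \<Longrightarrow> a < b \<Longrightarrow> \<exists>c\<in>B. a < c \<and> c < b"
  shows "card A \<le> card B + 1"
proof -
  \<comment> \<open>The claim is sharpened to count only separators below some element of A; then
    each new maximum brings a separator not counted before.\<close>
  have "card A \<le> card {c\<in>B. \<exists>a\<in>A. c < a} + 1"
    using assms(1,3)
  proof (induction A rule: finite_linorder_max_induct)
    case (insert b A)
    show ?case
    proof (cases "A = {}")
      case False
      let ?B = "\<lambda>A. {c\<in>B. \<exists>a\<in>A. c < a}"
      have "Max A \<in> A" using False insert by simp
      then obtain c where c: "c \<in> B" "Max A < c" "c < b"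
        using insert.prems[of "Max A" b] insert.hyps by blast
      have "\<not> (\<exists>a\<in>A. c < a)"
        using c(2) insert.hyps(1) by (meson Max_ge less_le_not_le order.strict_trans2)
      then have "c \<notin> ?B A" by blast
      moreover have "insert c (?B A) \<subseteq> ?B (insert b A)" using c by blast
      ultimately have "card (?B A) + 1 \<le> card (?B (insert b A))"
        using card_mono[of "?B (insert b A)" "insert c (?B A)"] assms(2) by simp
      moreover have "card A \<le> card (?B A) + 1" using insert by blast
      moreover have "b \<notin> A" using insert.hyps by blast
      ultimately show ?thesis using insert.hyps(1) by simp
    qed simp
  qed simp
  also have "card {c\<in>B. \<exists>a\<in>A. c < a} \<le> card B" by (rule card_mono) (use assms in auto)
  finally show ?thesis by simp
qed

lemma card_real_roots_pderiv:
  fixes p :: "real poly"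
  assumes "pderiv p \<noteq> 0"
  shows "card {x. poly p x = 0} \<le> card {x. poly (pderiv p) x = 0} + 1"
proof (rule card_le_separating)
  have "p \<noteq> 0" using assms by auto
  then show "finite {x. poly p x = 0}" by (rule poly_roots_finite)
  show "finite {x. poly (pderiv p) x = 0}" using assms by (rule poly_roots_finite)
  fix a b assume "a \<in> {x. poly p x = 0}" "b \<in> {x. poly p x = 0}" "a < b"
  then show "\<exists>c\<in>{x. poly (pderiv p) x = 0}. a < c \<and> c < b"
    using poly_MVT[of a b p] by auto
qed

text \<open>Differentiation moves the gap down one place and lowers the degree by one, while by
  Rolle at most one real root is lost. At \<open>i = 0\<close> the root 0 is at least double but
  counted once.\<close>

lemma card_real_roots_less_degree:
  fixes p :: "real poly"
  assumes "i < Polynomial.degree p" "poly.coeff p i = 0" "poly.coeff p (Suc i) = 0"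
  shows "card {x. poly p x = 0} < Polynomial.degree p"
  using assms
proof (induction i arbitrary: p)
  case 0
  obtain a b q where p: "p = pCons a (pCons b q)" by (metis pCons_cases)
  then have p: "p = pCons 0 (pCons 0 q)" using 0 by simp
  have q: "q \<noteq> 0" using 0(1) by (auto simp: p)
  have "{x. poly p x = 0} \<subseteq> insert 0 {x. poly q x = 0}" by (auto simp: p)
  then have "card {x. poly p x = 0} \<le> card (insert 0 {x. poly q x = 0})"
    by (rule card_mono[rotated]) (use q poly_roots_finite in auto)
  also have "\<dots> \<le> Suc (card {x. poly q x = 0})" by (rule card_insert_le_m1) auto
  also have "\<dots> \<le> Suc (Polynomial.degree q)" using card_poly_roots_bound[OF q] by simp
  also have "\<dots> < Polynomial.degree p" using q by (simp add: p)
  finally show ?case .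
next
  case (Suc i)
  have deg: "Polynomial.degree (pderiv p) = Polynomial.degree p - 1" by (rule degree_pderiv)
  have "pderiv p \<noteq> 0" using Suc.prems(1) by (auto simp: pderiv_eq_0_iff)
  moreover have "card {x. poly (pderiv p) x = 0} < Polynomial.degree (pderiv p)"
    by (rule Suc.IH) (use Suc.prems deg in \<open>auto simp: coeff_pderiv\<close>)
  ultimately show ?case using card_real_roots_pderiv[of p] deg by linarith
qed

text \<open>The nodes are complex numbers, whereas Rolle's theorem needs a polynomial over the
  reals; this transfers the vanishing coefficients.\<close>

lemma coeff_prod_linear_of_real:
  assumes "finite U"
  shows "poly.coeff (\<Prod>s\<in>of_real ` U. [:- s, 1:]) i
    = (of_real (poly.coeff (\<Prod>s\<in>U. [:- s, 1:]) i) :: complex)"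
proof -
  have "poly.coeff (\<Prod>s\<in>U. [:- of_real s, 1:]) i
    = (of_real (poly.coeff (\<Prod>s\<in>U. [:- s, 1:]) i) :: complex)"
    using assms
  proof (induction U arbitrary: i)
    case empty
    show ?case by simp
  next
    case (insert x U)
    then show ?case by (simp add: coeff_pCons split: nat.split)
  qed
  then show ?thesis by (subst prod.reindex) (auto simp: inj_on_def)
qed

lemma power_sum_rep_Reals_ge:
  assumes "has_power_sum_rep \<real> (2 * k) (var_x ^ k * var_y ^ k) r" and "0 < k"
  shows "2 * k \<le> r"
proof (rule ccontr)
  assume r: "\<not> 2 * k \<le> r"
  obtain T :: "complex set" and \<mu> D where T: "finite T" "T \<subseteq> \<real>" "D \<le> 2 * k" "card T + 2 * k \<le> r + D"
    "\<forall>i\<le>D. (\<Sum>s\<in>T. \<mu> s * s ^ i) = (if i = k then 1 / of_nat (2 * k choose k) else 0)"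
    "2 * k \<le> D + 1"
    by (rule power_sum_rep_nodes[OF assms Reals_divide])
  obtain U where "T = of_real ` U" "inj_on (of_real :: real \<Rightarrow> complex) U"
    using T(2) unfolding Reals_def subset_image_inj by blast
  with T(1) have U: "T = of_real ` U" "finite U" "card U = card T"
    by (auto simp: card_image finite_image_iff)
  let ?h = "\<Prod>s\<in>U. [:- s, 1:]"
  have deg: "Polynomial.degree ?h = card T"
    by (subst degree_prod_eq_sum_degree) (auto simp: U)
  \<comment> \<open>Fewer than 2k forms force \<open>card T < D\<close>, so the shifts 0 and 1 are
    both admissible.\<close>
  have zero: "poly.coeff ?h (k - i) = 0" if "i \<le> 1" for i
  proof -
    have "poly.coeff (\<Prod>s\<in>T. [:- s, 1:]) (k - i) = 0"
      by (rule node_polynomial_coeff_zero[OF T(1) _ T(5)[rule_format]]) (use T r that assms(2) in auto)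
    then show ?thesis unfolding U(1) coeff_prod_linear_of_real[OF U(2)] by simp
  qed
  have "k < card T" by (rule card_nodes_gt[OF T(1) _ _ T(5)[rule_format]]) (use T assms(2) in auto)
  then have "card {x. poly ?h x = 0} < Polynomial.degree ?h"
    using zero[of 0] zero[of 1] assms(2) deg
    by (intro card_real_roots_less_degree[of "k - 1"]) auto
  moreover have "{x. poly ?h x = 0} = U" using U(2) by (auto simp: poly_prod)
  ultimately show False using deg U(3) by simp
qed

section \<open>Quadrature rules and the real representation\<close>

lemma quadrature_weights:
  fixes U :: "'a::field set"
  assumes "finite U"
  obtains \<mu> where "\<forall>i<card U. (\<Sum>s\<in>U. \<mu> s * s ^ i) = (if i = m then 1 else 0)"
proof -
  \<comment> \<open>The Lagrange basis. Its m-th coefficients serve as weights, since interpolation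
    reproduces every monomial of degree below \<open>card U\<close>.\<close>
  define L where "L s = smult (1 / (\<Prod>t\<in>U - {s}. s - t)) (\<Prod>t\<in>U - {s}. [:- t, 1:])" for s
  have "(\<Sum>s\<in>U. poly.coeff (L s) m * s ^ i) = (if i = m then 1 else 0)" if i: "i < card U" for i
  proof -
    have "Polynomial.monom 1 i = (\<Sum>s\<in>U. smult (s ^ i) (L s))"
    proof (rule poly_eqI_degree[of U])
      fix x assume x: "x \<in> U"
      have "poly (L s) x = (if s = x then 1 else 0)" if "s \<in> U" for s
        using assms x by (auto simp: L_def poly_prod)
      then have "(\<Sum>s\<in>U. s ^ i * poly (L s) x) = (\<Sum>s\<in>U. if s = x then x ^ i else 0)"
        by (intro sum.cong) auto
      then show "poly (Polynomial.monom 1 i) x = poly (\<Sum>s\<in>U. smult (s ^ i) (L s)) x"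
        using assms x by (simp add: poly_monom poly_sum)
    next
      show "Polynomial.degree (Polynomial.monom (1::'a) i) < card U"
        using i by (simp add: degree_monom_eq)
      have "Polynomial.degree (L s) \<le> card U - 1" if "s \<in> U" for s
        unfolding L_def using assms that
        by (intro order.trans[OF degree_smult_le]) (subst degree_prod_eq_sum_degree, auto)
      then have "Polynomial.degree (\<Sum>s\<in>U. smult (s ^ i) (L s)) \<le> card U - 1"
        using assms by (intro degree_sum_le) (auto intro: order.trans[OF degree_smult_le])
      then show "Polynomial.degree (\<Sum>s\<in>U. smult (s ^ i) (L s)) < card U"
        using i by linarith
    qed
    from arg_cong[OF this, of "\<lambda>p. poly.coeff p m"] show ?thesis
      by (simp add: coeff_sum mult.commute eq_commute)
  qed
  then show ?thesis by (intro that[of "\<lambda>s. poly.coeff (L s) m"]) blast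
qed

text \<open>On a symmetric node set the weights can be chosen with the parity of \<open>m\<close>, which makes
  one further moment vanish.\<close>

lemma symmetric_quadrature_weights:
  fixes U :: "real set"
  assumes "finite U" "uminus ` U = U" "odd (card U + m)"
  obtains \<nu> where "\<forall>i\<le>card U. (\<Sum>s\<in>U. \<nu> s * s ^ i) = (if i = m then 1 else 0)"
proof -
  obtain \<mu> where \<mu>: "\<forall>i<card U. (\<Sum>s\<in>U. \<mu> s * s ^ i) = (if i = m then 1 else 0)"
    by (rule quadrature_weights[OF assms(1)])
  define \<nu> where "\<nu> s = (\<mu> s + (-1) ^ m * \<mu> (- s)) / 2" for s
  define M where "M i = (\<Sum>s\<in>U. \<mu> s * s ^ i)" for i
  have mirror: "(\<Sum>s\<in>U. \<mu> (- s) * s ^ i) = (-1) ^ i * M i" for i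
  proof -
    have "(\<Sum>s\<in>U. \<mu> (- s) * s ^ i) = (\<Sum>s\<in>uminus ` U. \<mu> s * (- s) ^ i)"
      by (simp add: sum.reindex)
    also have "\<dots> = (-1) ^ i * M i"
      unfolding assms(2) M_def sum_distrib_left by (rule sum.cong[OF refl], subst power_minus) simp
    finally show ?thesis .
  qed
  have "(\<Sum>s\<in>U. \<nu> s * s ^ i) = (if i = m then 1 else 0)" if i: "i \<le> card U" for i
  proof -
    have "(\<Sum>s\<in>U. \<nu> s * s ^ i) = ((\<Sum>s\<in>U. \<mu> s * s ^ i) + (-1) ^ m * (\<Sum>s\<in>U. \<mu> (- s) * s ^ i)) / 2"
      unfolding sum_distrib_left sum_divide_distrib sum.distrib[symmetric]
      by (rule sum.cong) (auto simp: \<nu>_def field_simps)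
    also have "\<dots> = (M i + (-1) ^ (m + i) * M i) / 2"
      unfolding mirror by (simp add: M_def power_add)
    also have "\<dots> = (if i = m then 1 else 0)"
    proof (cases "i = card U")
      case True
      \<comment> \<open>The parity assumption makes the sign -1, so the unknown moment cancels; it
        also excludes \<open>m = card U\<close>.\<close>
      then show ?thesis using assms(3) by (auto simp: add.commute)
    next
      case False
      then have "M i = (if i = m then 1 else 0)" using \<mu> i by (simp add: M_def)
      then show ?thesis by (simp add: mult_2[symmetric])
    qed
    finally show ?thesis .
  qed
  then show ?thesis by (intro that[of \<nu>]) blast
qed

text \<open>Parity decides the node set. For odd k, 2k symmetric nonzero integers control all
  moments up to 2k. For even k, 2k - 1 symmetric integers including 0 control those below 2k, and
  the form y repairs the top one.\<close>

lemma power_sum_rep_Reals: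
  assumes "0 < k"
  shows "has_power_sum_rep \<real> (2 * k) (var_x ^ k * var_y ^ k) (2 * k)"
proof (cases "odd k")
  case True
  define U where "U = real_of_int ` ({- int k..int k} - {0})"
  have "card U = card ({- int k..int k} - {0})"
    unfolding U_def by (rule card_image) (simp add: inj_on_def)
  then have U: "finite U" "card U = 2 * k" by (simp_all add: U_def)
  have "uminus ` U = U"
  proof -
    have "uminus ` ({- int k..int k} - {0}) = {- int k..int k} - {0}"
      by (simp add: image_set_diff inj_def)
    then show ?thesis
      unfolding U_def image_image of_int_minus[symmetric] by (metis image_image)
  qed
  then obtain \<nu> where \<nu>: "\<forall>i\<le>card U. (\<Sum>s\<in>U. \<nu> s * s ^ i) = (if i = k then 1 else 0)"
    using symmetric_quadrature_weights[OF U(1), of k] True U(2) by auto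
  show ?thesis
  proof (rule power_sum_repI[OF U])
    show "complex_of_real (\<nu> s) / of_nat (2 * k choose k) \<in> \<real> \<and> 1 \<in> \<real> \<and> complex_of_real s \<in> \<real>" for s
      by (auto intro!: Reals_divide)
    fix i assume "i \<le> 2 * k"
    then have "(\<Sum>s\<in>U. \<nu> s * s ^ i) = (if i = k then 1 else 0)" using \<nu> U(2) by simp
    then have "complex_of_real (\<Sum>s\<in>U. \<nu> s * s ^ i) / of_nat (2 * k choose k)
        = (if i = k then 1 / of_nat (2 * k choose k) else 0)" by simp
    then show "(\<Sum>s\<in>U. complex_of_real (\<nu> s) / of_nat (2 * k choose k) * 1 ^ (2 * k - i) * of_real s ^ i)
        = (if i = k then 1 / of_nat (2 * k choose k) else 0)"
      by (simp add: sum_divide_distrib)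
  qed
next
  case False
  define U where "U = real_of_int ` {- int (k - 1)..int (k - 1)}"
  have "card U = card {- int (k - 1)..int (k - 1)}"
    unfolding U_def by (rule card_image) (simp add: inj_on_def)
  then have U: "finite U" "card U = 2 * k - 1" using assms by (simp_all add: U_def)
  have kU: "real k \<notin> U" using assms by (auto simp: U_def)
  have "uminus ` U = U"
  proof -
    have "uminus ` {- int (k - 1)..int (k - 1)} = {- int (k - 1)..int (k - 1)}" by simp
    then show ?thesis
      unfolding U_def image_image of_int_minus[symmetric] by (metis image_image)
  qed
  then obtain \<nu> where \<nu>: "\<forall>i\<le>card U. (\<Sum>s\<in>U. \<nu> s * s ^ i) = (if i = k then 1 else 0)"
    using symmetric_quadrature_weights[OF U(1), of k] False U(2) assms by auto
  \<comment> \<open>The extra index \<open>real k\<close> carries the form y, which corrects the top moment.\<close>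
  define l where "l s = (if s = real k then - (\<Sum>s\<in>U. \<nu> s * s ^ (2 * k)) else \<nu> s)" for s
  let ?C = "of_nat (2 * k choose k) :: complex"
  let ?a = "\<lambda>s. if s = real k then 0 else 1 :: complex"
  let ?b = "\<lambda>s. if s = real k then 1 else complex_of_real s"
  show ?thesis
  proof (rule power_sum_repI)
    show "finite (insert (real k) U)" "card (insert (real k) U) = 2 * k"
      using U kU assms by simp_all
    show "of_real (l s) / ?C \<in> \<real> \<and> ?a s \<in> \<real> \<and> ?b s \<in> \<real>" for s
      by (auto intro!: Reals_divide)
    fix i assume i: "i \<le> 2 * k"
    have "(\<Sum>s\<in>U. of_real (l s) / ?C * ?a s ^ (2 * k - i) * ?b s ^ i)
        = (\<Sum>s\<in>U. of_real (\<nu> s * s ^ i) / ?C)"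
      using kU by (intro sum.cong) (auto simp: l_def)
    also have "\<dots> = of_real (\<Sum>s\<in>U. \<nu> s * s ^ i) / ?C" by (simp add: sum_divide_distrib)
    finally have "(\<Sum>s\<in>insert (real k) U. of_real (l s) / ?C * ?a s ^ (2 * k - i) * ?b s ^ i)
        = of_real (l (real k)) / ?C * 0 ^ (2 * k - i) + of_real (\<Sum>s\<in>U. \<nu> s * s ^ i) / ?C"
      using U(1) kU by simp
    also have "\<dots> = (if i = k then 1 / ?C else 0)"
    proof (cases "i = 2 * k")
      case True
      then show ?thesis using assms by (simp add: l_def)
    next
      case False
      then have "(\<Sum>s\<in>U. \<nu> s * s ^ i) = (if i = k then 1 else 0)" using \<nu> U(2) i by simp
      then show ?thesis using False i by (simp del: of_real_sum)
    qed
    finally show "(\<Sum>s\<in>insert (real k) U. of_real (l s) / ?C * ?a s ^ (2 * k - i) * ?b s ^ i)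
        = (if i = k then 1 / of_nat (2 * k choose k) else 0)" .
  qed
qed

theorem mainTheorem3:
  fixes k :: nat and z w :: complex
  assumes "k \<ge> 3"
    and "primitive_root_of_unity (k + 1) z"
    and "primitive_root_of_unity k w"
  shows "form_length (rat_adjoin z) (2 * k) (var_x ^ k * var_y ^ k) = enat (k + 1)
    \<and> form_length (rat_adjoin w) (2 * k) (var_x ^ k * var_y ^ k) = enat (k + 2)
    \<and> form_length \<real> (2 * k) (var_x ^ k * var_y ^ k) = enat (2 * k)
    \<and> 2 * k > k + 2"
proof (intro conjI)
  have k: "0 < k" using assms(1) by simp
  show "form_length (rat_adjoin z) (2 * k) (var_x ^ k * var_y ^ k) = enat (k + 1)"
    by (intro form_length_eqI power_sum_rep_primitive_succ assms(2))
      (rule power_sum_rep_ge[OF _ k rat_adjoin_divide])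
  show "form_length (rat_adjoin w) (2 * k) (var_x ^ k * var_y ^ k) = enat (k + 2)"
  proof (rule form_length_eqI[OF power_sum_rep_primitive[OF assms(3)]])
    fix s assume s: "has_power_sum_rep (rat_adjoin w) (2 * k) (var_x ^ k * var_y ^ k) s"
    have "k + 1 \<le> s" by (rule power_sum_rep_ge[OF s k rat_adjoin_divide])
    \<comment> \<open>Equality would force the (k+1)-th root of unity z into Q(w).\<close>
    moreover have "s \<noteq> k + 1"
    proof
      assume "s = k + 1"
      then have "z \<in> rat_adjoin w"
        using minimal_rep_contains_roots_of_unity[OF _ k rat_adjoin_divide, of w z] s assms(2)
        by (auto simp: primitive_root_of_unity_def)
      moreover have "z \<notin> rat_adjoin w"
        using next_primitive_root_not_in_rat_adjoin[OF assms(1) _ assms(2)] assms(3)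
        by (simp add: primitive_root_of_unity_def)
      ultimately show False by blast
    qed
    ultimately show "k + 2 \<le> s" by simp
  qed
  show "form_length \<real> (2 * k) (var_x ^ k * var_y ^ k) = enat (2 * k)"
    by (rule form_length_eqI[OF power_sum_rep_Reals[OF k] power_sum_rep_Reals_ge[OF _ k]])
  show "2 * k > k + 2" using assms(1) by simp
qed

end
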